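(* Let $d\ge 1$ be an integer with $d\mid q-1$, and let $\alpha,\beta,\gamma\in\widehat{\kappa^\times}$ satisfy $\alpha\neq\gamma$ and $\beta\neq\varepsilon$. Let $\varphi_d\in\widehat{\kappa^\times}$ be a character of exact order $d$ and let $\xi\in\kappa^\times$ be a primitive $d$th root of unity. Then, for any $\lambda\in\kappa^\times$, $$F_D^{(2d-1)}\left({\alpha^d;\overbrace{\alpha\overline{\gamma},\dots,\alpha\overline{\gamma}}^{d-1\text{ times}},\overbrace{\beta,\dots,\beta}^{d\text{ times}}\atop\alpha^{d-1}\gamma};\xi,\dots,\xi^{d-1},\lambda,\xi\lambda,\dots,\xi^{d-1}\lambda\right)=\sum_{i=0}^{d-1}\frac{g(\varphi_d^i\alpha)\,g^\circ(\alpha^{d-1}\gamma)}{g(\alpha^d)\,g^\circ(\varphi_d^i\gamma)}\,{}_2F_1\left({\varphi_d^i\alpha,\beta\atop\varphi_d^i\gamma};\lambda^d\right).$$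
   Context: $\kappa$ is a finite field with $q$ elements of characteristic $p$. $\widehat{\kappa^\times}=\mathrm{Hom}(\kappa^\times,\overline{\mathbb{Q}}^\times)$ is the group of multiplicative characters, $\varepsilon$ the trivial character, $\overline{\eta}=\eta^{-1}$; every $\eta\in\widehat{\kappa^\times}$ (including $\varepsilon$) is extended to $\kappa$ by $\eta(0)=0$. $\delta(\eta)=1$ if $\eta=\varepsilon$ and $0$ otherwise. Fix a non-trivial additive character $\psi\in\mathrm{Hom}(\kappa,\overline{\mathbb{Q}}^\times)$. Put $$g(\eta)=-\sum_{x\in\kappa^\times}\psi(x)\eta(x),\quad g^\circ(\eta)=q^{\delta(\eta)}g(\eta),\quad(\alpha)_\nu=\frac{g(\alpha\nu)}{g(\alpha)},\quad(\alpha)_\nu^\circ=\frac{g^\circ(\alpha\nu)}{g^\circ(\alpha)}.$$ For $\lambda\in\kappa$, $${}_2F_1\left({\alpha,\beta\atop\gamma};\lambda\right)=\frac{1}{1-q}\sum_{\nu\in\widehat{\kappa^\times}}\frac{(\alpha)_\nu(\beta)_\nu}{(\varepsilon)_\nu^\circ(\gamma)_\nu^\circ}\nu(\lambda),$$ and for $\lambda_1,\dots,\lambda_n\in\kappa$, $$F_D^{(n)}\left({\alpha;\beta_1,\dots,\beta_n\atop\gamma};\lambda_1,\dots,\lambda_n\right)=\frac{1}{(1-q)^n}\sum_{\nu_1,\dots,\nu_n\in\widehat{\kappa^\times}}\frac{(\alpha)_{\nu_1\cdots\nu_n}(\beta_1)_{\nu_1}\cdots(\beta_n)_{\nu_n}}{(\gamma)^\circ_{\nu_1\cdots\nu_n}(\varepsilon)^\circ_{\nu_1}\cdots(\varepsilon)^\circ_{\nu_n}}\nu_1(\lambda_1)\cdots\nu_n(\lambda_n).$$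 *)

theory Defs
  imports "HOL-Algebra.Algebraic_Closure_Type" "HOL-Library.Cardinality" "HOL-Library.FuncSet"
begin

type_synonym qbar = "rat alg_closure"

text \<open>
  A multiplicative character is a homomorphism from the non-zero elements of \<open>'k\<close> to those
  of \<open>'c\<close>, stored with its extension by \<open>0\<close> at \<open>0\<close>; this extension applies to the trivial
  character too, so the unit \<open>1\<close> of the character group is not the constant function.
\<close>

typedef (overloaded) ('k :: field, 'c :: field) mult_char =
  "{f :: 'k \<Rightarrow> 'c. f 0 = 0 \<and> (\<forall>x. x \<noteq> 0 \<longrightarrow> f x \<noteq> 0) \<and>
      (\<forall>x y. x \<noteq> 0 \<longrightarrow> y \<noteq> 0 \<longrightarrow> f (x * y) = f x * f y)}"
  morphisms char_at Abs_mult_char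
  by (rule exI[of _ "\<lambda>x. if x = 0 then 0 else 1"]) auto

setup_lifting type_definition_mult_char

instantiation mult_char :: (field, field) "{comm_monoid_mult, inverse}"
begin

lift_definition one_mult_char :: "('a, 'b) mult_char"
  is "\<lambda>x. if x = 0 then 0 else 1" by auto

lift_definition times_mult_char ::
  "('a, 'b) mult_char \<Rightarrow> ('a, 'b) mult_char \<Rightarrow> ('a, 'b) mult_char"
  is "\<lambda>\<eta> \<nu> x. \<eta> x * \<nu> x" by (simp add: mult.assoc mult.left_commute)

lift_definition inverse_mult_char :: "('a, 'b) mult_char \<Rightarrow> ('a, 'b) mult_char"
  is "\<lambda>\<eta> x. inverse (\<eta> x)" by simp

definition divide_mult_char ::
  "('a, 'b) mult_char \<Rightarrow> ('a, 'b) mult_char \<Rightarrow> ('a, 'b) mult_char"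
  where "divide_mult_char \<eta> \<nu> = \<eta> * inverse \<nu>"

instance
proof
  fix a b c :: "('a, 'b) mult_char"
  show "a * b * c = a * (b * c)" by transfer (simp add: mult.assoc)
  show "a * b = b * a" by transfer (simp add: mult.commute)
  show "1 * a = a" by transfer (auto simp: fun_eq_iff)
qed

end

lemma mult_char_right_inverse: "\<eta> * inverse \<eta> = (1 :: ('k :: field, 'c :: field) mult_char)"
  by transfer (auto simp: fun_eq_iff)

lemma char_at_zero: "char_at \<eta> 0 = 0"
  and char_at_nonzero: "x \<noteq> 0 \<Longrightarrow> char_at \<eta> x \<noteq> 0"
  and char_at_mult: "x \<noteq> 0 \<Longrightarrow> y \<noteq> 0 \<Longrightarrow> char_at \<eta> (x * y) = char_at \<eta> x * char_at \<eta> y"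
  using char_at[of \<eta>] by blast+

lemma char_at_one: "char_at \<eta> 1 = 1"
  using char_at_mult[of 1 1 \<eta>] char_at_nonzero[of 1 \<eta>] by simp

lemma char_at_power: "x \<noteq> 0 \<Longrightarrow> char_at \<eta> (x ^ n) = char_at \<eta> x ^ n"
  by (induction n) (simp_all add: char_at_one char_at_mult)

text \<open>The character group of a finite field is finite, so that sums over \<open>UNIV\<close> make sense.\<close>

instance mult_char :: ("{field, finite}", field) finite
proof
  define m where "m = card (- {0 :: 'a})"
  define R where "R = insert 0 {y :: 'b. poly (monom 1 m - 1) y = 0}"
  have "(1 :: 'a) \<in> - {0}" by simp
  then have m: "m > 0"
    unfolding m_def by (metis card_gt_0_iff empty_iff finite)
  have unit: "x ^ m = 1" if "x \<noteq> 0" for x :: 'a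
  proof -
    have "bij_betw ((*) x) (- {0}) (- {0})"
      using that by (intro bij_betwI[where g = "(*) (inverse x)"]) auto
    then have "(\<Prod>y\<in>- {0}. x * y) = \<Prod>(- {0 :: 'a})"
      by (rule prod.reindex_bij_betw)
    then have "x ^ m * \<Prod>(- {0 :: 'a}) = \<Prod>(- {0})"
      by (simp add: prod.distrib m_def)
    then show ?thesis by simp
  qed
  have "poly (monom 1 m - 1 :: 'b poly) 0 \<noteq> 0"
    using m by (simp add: poly_monom zero_power)
  then have "(monom 1 m - 1 :: 'b poly) \<noteq> 0"
    by (metis poly_0)
  then have fin: "finite R"
    unfolding R_def by (intro finite.insertI poly_roots_finite)
  have "char_at \<eta> x \<in> R" for \<eta> :: "('a, 'b) mult_char" and x
  proof (cases "x = 0")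
    case True
    then show ?thesis by (simp add: R_def char_at_zero)
  next
    case False
    then have "char_at \<eta> x ^ m = 1"
      using char_at_power[OF False, of \<eta> m] by (simp add: unit char_at_one)
    then show ?thesis by (simp add: R_def poly_monom)
  qed
  then have "range (char_at :: ('a, 'b) mult_char \<Rightarrow> _) \<subseteq> (UNIV \<rightarrow>\<^sub>E R)"
    by (intro image_subsetI PiE_I) simp_all
  then have "finite (range (char_at :: ('a, 'b) mult_char \<Rightarrow> _))"
    by (rule finite_subset) (intro finite_PiE finite fin)
  then show "finite (UNIV :: ('a, 'b) mult_char set)"
    by (rule finite_imageD) (intro injI, simp only: char_at_inject)
qed

definition add_char :: "('k :: field \<Rightarrow> 'c :: field) \<Rightarrow> bool" where
  "add_char \<psi> \<longleftrightarrow> (\<forall>x. \<psi> x \<noteq> 0) \<and> (\<forall>x y. \<psi> (x + y) = \<psi> x * \<psi> y)"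

definition has_order :: "'a :: monoid_mult \<Rightarrow> nat \<Rightarrow> bool" where
  "has_order x d \<longleftrightarrow> d > 0 \<and> x ^ d = 1 \<and> (\<forall>k. 0 < k \<and> k < d \<longrightarrow> x ^ k \<noteq> 1)"

definition gauss :: "('k :: {field, finite} \<Rightarrow> 'c :: field) \<Rightarrow> ('k, 'c) mult_char \<Rightarrow> 'c" where
  "gauss \<psi> \<eta> = - (\<Sum>x\<in>UNIV - {0}. \<psi> x * char_at \<eta> x)"

definition gauss_circ :: "('k :: {field, finite} \<Rightarrow> 'c :: field) \<Rightarrow> ('k, 'c) mult_char \<Rightarrow> 'c" where
  "gauss_circ \<psi> \<eta> = of_nat CARD('k) ^ (if \<eta> = 1 then 1 else 0) * gauss \<psi> \<eta>"

definition poch ::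
  "('k :: {field, finite} \<Rightarrow> 'c :: field) \<Rightarrow> ('k, 'c) mult_char \<Rightarrow> ('k, 'c) mult_char \<Rightarrow> 'c" where
  "poch \<psi> \<alpha> \<nu> = gauss \<psi> (\<alpha> * \<nu>) / gauss \<psi> \<alpha>"

definition poch_circ ::
  "('k :: {field, finite} \<Rightarrow> 'c :: field) \<Rightarrow> ('k, 'c) mult_char \<Rightarrow> ('k, 'c) mult_char \<Rightarrow> 'c" where
  "poch_circ \<psi> \<alpha> \<nu> = gauss_circ \<psi> (\<alpha> * \<nu>) / gauss_circ \<psi> \<alpha>"

definition hyp_2F1 ::
  "('k :: {field, finite} \<Rightarrow> 'c :: field) \<Rightarrow> ('k, 'c) mult_char \<Rightarrow> ('k, 'c) mult_char \<Rightarrow>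
    ('k, 'c) mult_char \<Rightarrow> 'k \<Rightarrow> 'c" where
  "hyp_2F1 \<psi> \<alpha> \<beta> \<gamma> l =
     1 / (1 - of_nat CARD('k)) *
     (\<Sum>\<nu>\<in>UNIV. poch \<psi> \<alpha> \<nu> * poch \<psi> \<beta> \<nu> / (poch_circ \<psi> 1 \<nu> * poch_circ \<psi> \<gamma> \<nu>) * char_at \<nu> l)"

text \<open>
  The parameters \<open>\<beta>\<^sub>1, \<dots>, \<beta>\<^sub>n\<close> and arguments \<open>\<lambda>\<^sub>1, \<dots>, \<lambda>\<^sub>n\<close> of the Lauricella function are
  functions on the naturals, only whose values at \<open>1, \<dots>, n\<close> are used.
\<close>

definition lauricella_FD ::
  "('k :: {field, finite} \<Rightarrow> 'c :: field) \<Rightarrow> nat \<Rightarrow> ('k, 'c) mult_char \<Rightarrow>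
    (nat \<Rightarrow> ('k, 'c) mult_char) \<Rightarrow> ('k, 'c) mult_char \<Rightarrow> (nat \<Rightarrow> 'k) \<Rightarrow> 'c" where
  "lauricella_FD \<psi> n \<alpha> \<beta> \<gamma> l =
     1 / (1 - of_nat CARD('k)) ^ n *
     (\<Sum>\<nu>\<in>{1..n} \<rightarrow>\<^sub>E UNIV.
        poch \<psi> \<alpha> (\<Prod>i=1..n. \<nu> i) * (\<Prod>i=1..n. poch \<psi> (\<beta> i) (\<nu> i)) /
        (poch_circ \<psi> \<gamma> (\<Prod>i=1..n. \<nu> i) * (\<Prod>i=1..n. poch_circ \<psi> 1 (\<nu> i))) *
        (\<Prod>i=1..n. char_at (\<nu> i) (l i)))"

end

theory Submission
  imports Defs
begin

text \<open>
  Both sides of the formula are Euler integrals over \<open>\<kappa>\<close>, and the substitution \<open>u = t\<^sup>d\<close> turns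
  one into the other.

  A quotient of Pochhammer symbols \<open>(\<alpha>)\<^sub>\<nu> / (\<gamma>)\<^sub>\<nu>\<^sup>\<circ>\<close> with \<open>\<alpha> \<noteq> \<gamma>\<close> is, up to a factor that does not
  depend on \<open>\<nu>\<close>, the Jacobi sum \<open>\<Sum>\<^sub>t \<alpha>\<nu>(t) \<gamma>\<alpha>\<^sup>-\<^sup>1(1 - t)\<close>; this is \<open>poch_quotient_jacobi\<close>. As \<open>\<nu>\<close> enters
  only through the factor \<open>\<nu>(t)\<close>, the multiple sum defining \<open>F\<^sub>D\<close> becomes a sum over \<open>t\<close> of
  products of one-variable sums \<open>\<Sum>\<^sub>\<nu> (\<beta>\<^sub>i)\<^sub>\<nu> / (\<epsilon>)\<^sub>\<nu>\<^sup>\<circ> \<nu>(\<lambda>\<^sub>i t)\<close>. For \<open>\<beta>\<^sub>i \<noteq> \<epsilon>\<close>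
  and \<open>\<lambda>\<^sub>i t \<noteq> 0\<close>, orthogonality of characters evaluates each of
  these as \<open>(1 - q) \<beta>\<^sub>i\<^sup>-\<^sup>1(1 - \<lambda>\<^sub>i t)\<close>, the analogue \<open>binomial_theorem_chars\<close> of the binomial series.
  The result is \<open>lauricella_FD_integral\<close>: \<open>F\<^sub>D\<close> is a constant times
  \<open>\<Sum>\<^sub>t \<alpha>(t) \<gamma>\<alpha>\<^sup>-\<^sup>1(1 - t) \<Prod>\<^sub>i \<beta>\<^sub>i\<^sup>-\<^sup>1(1 - \<lambda>\<^sub>i t)\<close>. The case of one variable is the integral for \<open>\<^sub>2F\<^sub>1\<close>.

  For the parameters of the theorem, put \<open>c = \<gamma>\<alpha>\<^sup>-\<^sup>1\<close>. The first \<open>d - 1\<close> factors together with the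
  factor \<open>c(1 - t)\<close> of the integral give \<open>c(\<Prod>\<^sub>i\<^sub><\<^sub>d (1 - \<xi>\<^sup>i t)) = c(1 - t\<^sup>d)\<close>, the remaining \<open>d\<close> factors give
  \<open>\<beta>\<^sup>-\<^sup>1(1 - \<lambda>\<^sup>d t\<^sup>d)\<close>, and \<open>\<alpha>\<^sup>d(t) = \<alpha>(t\<^sup>d)\<close>. So the integrand depends on \<open>t\<^sup>d\<close> only. Since \<open>u \<noteq> 0\<close>
  has \<open>\<Sum>\<^sub>i\<^sub><\<^sub>d \<phi>\<^sup>i(u)\<close> many \<open>d\<close>-th roots (\<open>card_power_fibre\<close>), the integral splits into \<open>d\<close> integrals, the
  \<open>i\<close>-th with \<open>\<phi>\<^sup>i\<alpha>\<close> in place of \<open>\<alpha>\<close> and with \<open>c = (\<phi>\<^sup>i\<gamma>)(\<phi>\<^sup>i\<alpha>)\<^sup>-\<^sup>1\<close> unchanged: these are the integrals of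
  the functions \<open>\<^sub>2F\<^sub>1\<close> on the right-hand side.
\<close>

section \<open>Multiplicative characters\<close>

lemma char_at_1: "char_at 1 x = (if x = 0 then 0 else 1)"
  by transfer simp

lemma char_at_times: "char_at (\<eta> * \<nu>) x = char_at \<eta> x * char_at \<nu> x"
  by transfer simp

lemma char_at_inverse: "char_at (inverse \<eta>) x = inverse (char_at \<eta> x)"
  by transfer simp

lemma char_at_mult_all: "char_at \<eta> (x * y) = char_at \<eta> x * char_at \<eta> y"
  by (cases "x = 0 \<or> y = 0") (auto simp: char_at_zero char_at_mult)

lemma char_at_inverse_arg: "char_at \<eta> (inverse x) = inverse (char_at \<eta> x)"
proof (cases "x = 0")
  case False
  then have "char_at \<eta> x * char_at \<eta> (inverse x) = 1"
    by (simp flip: char_at_mult_all add: char_at_one)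
  then show ?thesis by (simp add: inverse_unique)
qed (simp add: char_at_zero)

lemma char_at_pow: "x \<noteq> 0 \<Longrightarrow> char_at (\<eta> ^ n) x = char_at \<eta> x ^ n"
  by (induction n) (simp_all add: char_at_1 char_at_times)

lemma char_at_prod: "x \<noteq> 0 \<Longrightarrow> char_at (\<Prod>i\<in>A. \<nu> i) x = (\<Prod>i\<in>A. char_at (\<nu> i) x)"
  by (induction A rule: infinite_finite_induct) (simp_all add: char_at_1 char_at_times)

lemma char_at_prod_arg: "char_at \<eta> (\<Prod>i\<in>A. f i) = (\<Prod>i\<in>A. char_at \<eta> (f i))"
  by (induction A rule: infinite_finite_induct) (simp_all add: char_at_one char_at_mult_all)

lemma char_at_minus_one_square: "char_at \<eta> (- 1) * char_at \<eta> (- 1) = 1"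
  by (simp flip: char_at_mult_all add: char_at_one)

lemma mult_char_eqI: "(\<And>x. x \<noteq> 0 \<Longrightarrow> char_at \<eta> x = char_at \<nu> x) \<Longrightarrow> \<eta> = \<nu>"
  by (metis char_at_inject char_at_zero ext)

lemma mult_char_cancel_left: "\<eta> * \<mu> = \<eta> * \<nu> \<longleftrightarrow> \<mu> = (\<nu> :: ('k :: field, 'c :: field) mult_char)"
proof
  assume "\<eta> * \<mu> = \<eta> * \<nu>"
  then have "\<eta> * inverse \<eta> * \<mu> = \<eta> * inverse \<eta> * \<nu>"
    by (simp only: mult.assoc mult.left_commute[of \<eta> "inverse \<eta>"])
  then show "\<mu> = \<nu>" by (simp add: mult_char_right_inverse)
qed simp

lemma mult_inverse_eq_1_iff: "\<mu> * inverse \<nu> = 1 \<longleftrightarrow> \<mu> = (\<nu> :: ('k :: field, 'c :: field) mult_char)"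
  using mult_char_cancel_left[of "inverse \<nu>" \<mu> \<nu>]
  by (simp add: mult_char_right_inverse mult.commute)

lemma inverse_mult_char_cancel:
  "inverse \<mu> * (\<mu> * \<nu>) = (\<nu> :: ('k :: field, 'c :: field) mult_char)"
  "\<mu> * (inverse \<mu> * \<nu>) = \<nu>"
  by (simp_all flip: mult.assoc add: mult_char_right_inverse mult.commute[of _ \<mu>])

lemma card_field_gt_1: "CARD('k :: {field, finite}) > 1"
proof -
  have "card {0, 1 :: 'k} \<le> CARD('k)" by (rule card_mono) auto
  then show ?thesis by simp
qed

lemma sum_mult_char:
  fixes \<eta> :: "('k :: {field, finite}, 'c :: field) mult_char"
  shows "(\<Sum>x\<in>UNIV. char_at \<eta> x) = (if \<eta> = 1 then of_nat CARD('k) - 1 else 0)"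
proof (cases "\<eta> = 1")
  case True
  have "(\<Sum>x\<in>UNIV. char_at (1 :: ('k, 'c) mult_char) x) = (\<Sum>x\<in>UNIV - {0 :: 'k}. 1)"
    by (simp add: sum.remove[of UNIV 0] char_at_1)
  also have "\<dots> = of_nat CARD('k) - 1"
    by (simp add: card_Diff_singleton of_nat_diff Suc_leI card_gt_0_iff)
  finally show ?thesis using True by simp
next
  case False
  then obtain y where y: "y \<noteq> 0" "char_at \<eta> y \<noteq> 1"
    using mult_char_eqI[of \<eta> 1] by (auto simp: char_at_1)
  have "(\<Sum>x\<in>UNIV. char_at \<eta> x) = (\<Sum>x\<in>UNIV. char_at \<eta> (y * x))"
    by (rule sum.reindex_bij_witness[where i = "\<lambda>x. y * x" and j = "\<lambda>x. x / y"]) (use y in auto)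
  also have "\<dots> = char_at \<eta> y * (\<Sum>x\<in>UNIV. char_at \<eta> x)"
    by (simp add: char_at_mult_all sum_distrib_left)
  finally show ?thesis using y False by simp
qed

section \<open>The dual group separates points\<close>

text \<open>
  With \<open>e = gcd k m\<close> and \<open>f = m / e > 1\<close>, there is an \<open>f\<close>-th root of unity \<open>w \<noteq> 1\<close>, because
  \<open>1 + X + \<dots> + X\<^sup>f\<^sup>-\<^sup>1\<close> has a root and, in characteristic zero, that root is not \<open>1\<close>. Any \<open>e\<close>-th root of \<open>w\<close> is
  the required \<open>\<zeta>\<close>: were \<open>w\<^sup>k\<^sup>/\<^sup>e = \<zeta>\<^sup>k = 1\<close>, then \<open>w = 1\<close>, as \<open>k / e\<close> is prime to \<open>f\<close>.
\<close>

lemma root_of_unity_separating: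
  fixes m k :: nat
  assumes "m > 0" "\<not> m dvd k"
  shows "\<exists>\<zeta> :: 'c :: {alg_closed_field, field_char_0}. \<zeta> ^ m = 1 \<and> \<zeta> ^ k \<noteq> 1"
proof -
  define e where "e = gcd k m"
  have e: "e > 0" using assms(1) by (simp add: e_def)
  then obtain k' f where k': "k = k' * e" and f: "m = f * e" and cop: "coprime k' f"
    using gcd_coprime_exists[of k m] unfolding e_def by auto
  have f0: "f > 0" and k0: "k' \<noteq> 0" using assms f k' by (auto intro: gr0I)
  have f1: "f > 1" using assms(2) f0 f k' by (cases "f = 1") auto
  have "\<exists>w :: 'c. (\<Sum>j\<le>f - 1. 1 * w ^ j) = 0"
    using f1 by (intro alg_closed) auto
  moreover have "{..f - 1} = {..<f}" using f0 by auto
  ultimately obtain w :: 'c where w: "(\<Sum>j<f. w ^ j) = 0" by auto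
  have "w ^ f - 1 = (w - 1) * (\<Sum>j<f. w ^ j)" by (rule power_diff_1_eq)
  then have wf: "w ^ f = 1" using w by simp
  (* in characteristic zero the sum would be f, not 0, at w = 1 *)
  have w1: "w \<noteq> 1" using w f0 by auto
  obtain \<zeta> where z: "\<zeta> ^ e = w" using nth_root_exists[OF e] by blast
  have "\<zeta> ^ k \<noteq> 1"
  proof
    assume "\<zeta> ^ k = 1"
    then have wk: "w ^ k' = 1" unfolding k' by (simp add: mult.commute[of k'] power_mult z)
    obtain x y where "k' * x = f * y + gcd k' f"
      using bezout_nat[OF k0] by blast
    then have "w ^ (k' * x) = w ^ (f * y) * w" using cop by simp
    then show False using wk wf w1 by (simp add: power_mult)
  qed
  moreover have "\<zeta> ^ m = 1" unfolding f by (simp add: mult.commute[of f] power_mult z wf)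
  ultimately show ?thesis by blast
qed

lemma finite_field_generator:
  obtains g :: "'k :: {field, finite}"
  where "\<And>i j. g ^ i = g ^ j \<longleftrightarrow> i mod (CARD('k) - 1) = j mod (CARD('k) - 1)"
    and "\<And>x. x \<noteq> 0 \<Longrightarrow> \<exists>j. x = g ^ j"
proof -
  let ?R = "ring_of_type_algebra :: 'k ring"
  define m where "m = CARD('k) - 1"
  interpret R: field ?R by (rule field_from_type_algebra)
  have pow: "x [^]\<^bsub>?R\<^esub> (n :: nat) = x ^ n" for x n
    by (induction n) (simp_all add: R.nat_pow_0 R.nat_pow_Suc ring_of_type_algebra_def mult.commute)
  have carr: "carrier (mult_of ?R) = UNIV - {0}"
    by (simp add: ring_of_type_algebra_def)
  obtain g where g: "g \<in> UNIV - {0}" "UNIV - {0 :: 'k} = {g ^ i | i. i \<in> (UNIV :: nat set)}"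
    using R.finite_field_mult_group_has_gen unfolding carr pow
    by (auto simp: ring_of_type_algebra_def)
  have cardm: "card (UNIV - {0 :: 'k}) = m" by (simp add: m_def card_Diff_singleton)
  have m: "m > 0"
    using g(1) cardm by (metis card_gt_0_iff empty_iff finite)
  have gm: "g ^ m = 1"
  proof -
    have "bij_betw ((*) g) (UNIV - {0}) (UNIV - {0})"
      using g(1) by (intro bij_betwI[where g = "(*) (inverse g)"]) auto
    then have "(\<Prod>y\<in>UNIV - {0}. g * y) = \<Prod>(UNIV - {0 :: 'k})"
      by (rule prod.reindex_bij_betw)
    then have "g ^ m * \<Prod>(UNIV - {0 :: 'k}) = \<Prod>(UNIV - {0})"
      by (simp add: prod.distrib cardm)
    then show ?thesis by simp
  qed
  have red: "g ^ i = g ^ (i mod m)" for i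
    by (metis (no_types) gm mult_1 mult_div_mod_eq power_add power_mult power_one)
  have "(\<lambda>i. g ^ i) ` {..<m} = UNIV - {0}"
  proof
    show "UNIV - {0} \<subseteq> (\<lambda>i. g ^ i) ` {..<m}"
    proof
      fix x assume "x \<in> UNIV - {0 :: 'k}"
      then obtain i where "x = g ^ i" unfolding g(2) by blast
      then have "x = g ^ (i mod m)" using red[of i] by (rule trans)
      then show "x \<in> (\<lambda>i. g ^ i) ` {..<m}" using m by simp
    qed
  qed (use g(1) in auto)
  then have inj: "inj_on (\<lambda>i. g ^ i) {..<m}"
    by (intro eq_card_imp_inj_on) (simp_all add: cardm)
  have "g ^ i = g ^ j \<longleftrightarrow> i mod m = j mod m" for i j
    using inj_on_eq_iff[OF inj, of "i mod m" "j mod m"] m by (simp flip: red)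
  moreover have "\<exists>j. x = g ^ j" if "x \<noteq> 0" for x
  proof -
    have "x \<in> UNIV - {0}" using that by simp
    then show ?thesis unfolding g(2) by blast
  qed
  ultimately show thesis unfolding m_def by (rule that)
qed

text \<open>
  The discrete logarithm to the base of a generator \<open>g\<close> turns any \<open>\<zeta>\<close> with \<open>\<zeta>\<^sup>q\<^sup>-\<^sup>1 = 1\<close> into the character
  \<open>g\<^sup>j \<mapsto> \<zeta>\<^sup>j\<close>, and \<open>\<zeta>\<close> can be chosen to detect a given \<open>x = g\<^sup>k \<noteq> 1\<close>.
\<close>

lemma exists_char_ne_1:
  fixes x :: "'k :: {field, finite}"
  assumes "x \<noteq> 0" "x \<noteq> 1"
  shows "\<exists>\<nu> :: ('k, 'c :: {alg_closed_field, field_char_0}) mult_char. char_at \<nu> x \<noteq> 1"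
proof -
  define m where "m = CARD('k) - 1"
  obtain g :: 'k where eq: "\<And>i j. g ^ i = g ^ j \<longleftrightarrow> i mod m = j mod m"
    and gen: "\<And>x. x \<noteq> 0 \<Longrightarrow> \<exists>j. x = g ^ j"
    unfolding m_def using finite_field_generator by blast
  obtain k where k: "x = g ^ k" using gen assms(1) by blast
  have "\<not> m dvd k" using eq[of k 0] assms(2) k by auto
  moreover have "m > 0"
    using card_field_gt_1[where 'k = 'k] by (simp add: m_def)
  ultimately obtain \<zeta> :: 'c where z: "\<zeta> ^ m = 1" "\<zeta> ^ k \<noteq> 1"
    using root_of_unity_separating by blast
  define f where "f = (\<lambda>y. if y = 0 then 0 else \<zeta> ^ (SOME j. y = g ^ j))"
  have g0: "g \<noteq> 0" using k assms by (auto simp: power_0_left split: if_splits)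
  have red: "\<zeta> ^ i = \<zeta> ^ (i mod m)" for i
    by (metis (no_types) z(1) mult_1 mult_div_mod_eq power_add power_mult power_one)
  have f: "f (g ^ j) = \<zeta> ^ j" for j
  proof -
    have "g ^ j = g ^ (SOME i. g ^ j = g ^ i)" by (rule someI) simp
    then show ?thesis using g0 eq red by (metis f_def power_not_zero)
  qed
  have z0: "\<zeta> \<noteq> 0" using z \<open>m > 0\<close> by (metis power_0_left not_gr_zero zero_neq_one)
  have "f 0 = 0 \<and> (\<forall>x. x \<noteq> 0 \<longrightarrow> f x \<noteq> 0) \<and> (\<forall>x y. x \<noteq> 0 \<longrightarrow> y \<noteq> 0 \<longrightarrow> f (x * y) = f x * f y)"
  proof (intro conjI allI impI)
    fix x y :: 'k assume "x \<noteq> 0" "y \<noteq> 0"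
    then obtain i j where "x = g ^ i" "y = g ^ j" using gen by metis
    then show "f (x * y) = f x * f y" by (simp flip: power_add add: f)
  qed (use z0 in \<open>auto simp: f_def\<close>)
  then have "char_at (Abs_mult_char f) = f" by (simp add: Abs_mult_char_inverse)
  then show ?thesis using z(2) k f by metis
qed

text \<open>
  The value at \<open>x = 1\<close> is the number of characters. It comes from summing \<open>\<nu>(y)\<close> over all pairs
  \<open>(\<nu>, y)\<close>: summed over \<open>\<nu>\<close> first only \<open>y = 1\<close> contributes, summed over \<open>y\<close> first only \<open>\<nu> = \<epsilon>\<close>.
\<close>

lemma sum_char_at_over_chars:
  fixes x :: "'k :: {field, finite}"
  assumes "x \<noteq> 0"
  shows "(\<Sum>\<nu>\<in>(UNIV :: ('k, 'c :: {alg_closed_field, field_char_0}) mult_char set). char_at \<nu> x) =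
    (if x = 1 then of_nat CARD('k) - 1 else 0)"
proof -
  let ?C = "UNIV :: ('k, 'c) mult_char set"
  have ne1: "(\<Sum>\<nu>\<in>?C. char_at \<nu> y) = 0" if "y \<noteq> 1" for y
  proof (cases "y = 0")
    case False
    with that obtain \<mu> :: "('k, 'c) mult_char" where \<mu>: "char_at \<mu> y \<noteq> 1"
      using exists_char_ne_1 by blast
    have "(\<Sum>\<nu>\<in>?C. char_at \<nu> y) = (\<Sum>\<nu>\<in>?C. char_at (\<mu> * \<nu>) y)"
      by (rule sum.reindex_bij_witness[where i = "\<lambda>\<nu>. \<mu> * \<nu>" and j = "\<lambda>\<nu>. inverse \<mu> * \<nu>"])
        (simp_all add: inverse_mult_char_cancel)
    also have "\<dots> = char_at \<mu> y * (\<Sum>\<nu>\<in>?C. char_at \<nu> y)"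
      by (simp add: char_at_times sum_distrib_left)
    finally show ?thesis using \<mu> by simp
  qed (simp add: char_at_zero)
  have "(\<Sum>\<nu>\<in>?C. char_at \<nu> 1) = (\<Sum>y\<in>{1}. \<Sum>\<nu>\<in>?C. char_at \<nu> y)" by simp
  also have "\<dots> = (\<Sum>y\<in>UNIV. \<Sum>\<nu>\<in>?C. char_at \<nu> y)"
    by (rule sum.mono_neutral_left) (auto simp: ne1)
  also have "\<dots> = (\<Sum>\<nu>\<in>?C. \<Sum>y\<in>UNIV. char_at \<nu> y)"
    by (rule sum.swap)
  also have "\<dots> = of_nat CARD('k) - 1"
    by (simp add: sum_mult_char)
  finally show ?thesis using ne1 by simp
qed

section \<open>Gauss sums and Jacobi sums\<close>

definition jacobi :: "('k :: {field, finite}, 'c :: field) mult_char \<Rightarrow> ('k, 'c) mult_char \<Rightarrow> 'c" where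
  "jacobi \<eta> \<nu> = (\<Sum>t\<in>UNIV. char_at \<eta> t * char_at \<nu> (1 - t))"

lemma sum_add_char:
  fixes \<psi> :: "'k :: {field, finite} \<Rightarrow> 'c :: field"
  assumes "add_char \<psi>" and "\<exists>x. \<psi> x \<noteq> 1"
  shows "(\<Sum>x\<in>UNIV. \<psi> x) = 0"
proof -
  obtain y where y: "\<psi> y \<noteq> 1" using assms(2) by blast
  have "(\<Sum>x\<in>UNIV. \<psi> x) = (\<Sum>x\<in>UNIV. \<psi> (y + x))"
    by (rule sum.reindex_bij_witness[where i = "\<lambda>x. y + x" and j = "\<lambda>x. x - y"]) auto
  also have "\<dots> = \<psi> y * (\<Sum>x\<in>UNIV. \<psi> x)"
    using assms(1) by (simp add: add_char_def sum_distrib_left)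
  finally show ?thesis using y by simp
qed

lemma add_char_0: "add_char \<psi> \<Longrightarrow> \<psi> 0 = 1"
  unfolding add_char_def by (metis add_0 mult_cancel_right1)

lemma gauss_alt:
  "gauss \<psi> \<eta> = - (\<Sum>x\<in>UNIV. \<psi> x * char_at \<eta> x)"
  unfolding gauss_def by (simp add: sum.remove[of UNIV 0] char_at_zero)

lemma gauss_one:
  fixes \<psi> :: "'k :: {field, finite} \<Rightarrow> 'c :: field"
  assumes "add_char \<psi>" and "\<exists>x. \<psi> x \<noteq> 1"
  shows "gauss \<psi> 1 = 1"
proof -
  have "gauss \<psi> 1 = - (\<Sum>x\<in>UNIV - {0}. \<psi> x)"
    unfolding gauss_def by (simp add: char_at_1)
  also have "\<dots> = \<psi> 0 - (\<Sum>x\<in>UNIV. \<psi> x)"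
    by (simp add: sum.remove[of UNIV 0 \<psi>])
  finally show ?thesis using assms by (simp add: sum_add_char add_char_0)
qed

text \<open>
  For \<open>t \<noteq> 0\<close> the summand is \<open>\<nu>(1/t - 1)\<close>, and \<open>1/t - 1\<close> takes every value except \<open>-1\<close> once.
\<close>

lemma jacobi_inverse:
  assumes "\<nu> \<noteq> 1"
  shows "jacobi (inverse \<nu>) \<nu> = - char_at \<nu> (- 1)"
proof -
  have "jacobi (inverse \<nu>) \<nu> = (\<Sum>t\<in>UNIV - {0}. char_at (inverse \<nu>) t * char_at \<nu> (1 - t))"
    unfolding jacobi_def by (simp add: sum.remove[of UNIV 0] char_at_zero)
  also have "\<dots> = (\<Sum>v\<in>UNIV - {- 1}. char_at \<nu> v)"
  proof (rule sum.reindex_bij_witness[where i = "\<lambda>v. 1 / (v + 1)" and j = "\<lambda>t. 1 / t - 1"])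
    fix t :: 'a assume "t \<in> UNIV - {0}"
    then have "1 / t - 1 = inverse t * (1 - t)" by (simp add: field_simps)
    then show "char_at \<nu> (1 / t - 1) = char_at (inverse \<nu>) t * char_at \<nu> (1 - t)"
      by (simp only: char_at_mult_all char_at_inverse char_at_inverse_arg)
  qed (auto simp: add_eq_0_iff2)
  also have "\<dots> = (\<Sum>v\<in>UNIV. char_at \<nu> v) - char_at \<nu> (- 1)"
    by (simp add: sum.remove[of UNIV "- 1"])
  finally show ?thesis using assms by (simp add: sum_mult_char)
qed

text \<open>
  Collecting the terms \<open>\<psi>(x + y) \<eta>(x) \<nu>(y)\<close> of the product by \<open>s = x + y\<close>, each \<open>s \<noteq> 0\<close> contributes
  \<open>\<psi>(s) (\<eta>\<nu>)(s)\<close> times the Jacobi sum, by homogeneity. The term \<open>s = 0\<close> vanishes unless \<open>\<eta>\<nu> = \<epsilon>\<close>; in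
  that case it is \<open>-(q - 1)\<close> times the Jacobi sum, by \<open>jacobi_inverse\<close>, and the total factor \<open>-q\<close> is
  \<open>-g\<^sup>\<circ>(\<epsilon>)\<close>.
\<close>

lemma gauss_mult_gauss:
  fixes \<psi> :: "'k :: {field, finite} \<Rightarrow> 'c :: field"
  assumes \<psi>: "add_char \<psi>" "\<exists>x. \<psi> x \<noteq> 1" and \<nu>: "\<nu> \<noteq> 1"
  shows "gauss \<psi> \<eta> * gauss \<psi> \<nu> = - gauss_circ \<psi> (\<eta> * \<nu>) * jacobi \<eta> \<nu>"
proof -
  let ?c = "\<lambda>s. \<Sum>x\<in>UNIV. char_at \<eta> x * char_at \<nu> (s - x)"
  have inner: "?c s = char_at (\<eta> * \<nu>) s * jacobi \<eta> \<nu>" if "s \<noteq> 0" for s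
  proof -
    have "?c s = (\<Sum>t\<in>UNIV. char_at \<eta> (s * t) * char_at \<nu> (s - s * t))"
      by (rule sum.reindex_bij_witness[where i = "\<lambda>t. s * t" and j = "\<lambda>x. x / s"]) (use that in auto)
    also have "\<dots> = (\<Sum>t\<in>UNIV. char_at (\<eta> * \<nu>) s * (char_at \<eta> t * char_at \<nu> (1 - t)))"
    proof (rule sum.cong[OF refl])
      fix t
      have "s - s * t = s * (1 - t)" by (simp add: algebra_simps)
      then show "char_at \<eta> (s * t) * char_at \<nu> (s - s * t) =
          char_at (\<eta> * \<nu>) s * (char_at \<eta> t * char_at \<nu> (1 - t))"
        by (simp add: char_at_mult_all char_at_times)
    qed
    finally show ?thesis by (simp add: jacobi_def sum_distrib_left)
  qed
  have c0: "?c 0 = char_at \<nu> (- 1) * (\<Sum>x\<in>UNIV. char_at (\<eta> * \<nu>) x)"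
  proof -
    have "char_at \<nu> (0 - x) = char_at \<nu> (- 1) * char_at \<nu> x" for x
      by (simp flip: char_at_mult_all)
    then show ?thesis by (simp only: sum_distrib_left char_at_times mult_ac)
  qed
  have "gauss \<psi> \<eta> * gauss \<psi> \<nu> =
      (\<Sum>x\<in>UNIV. \<Sum>y\<in>UNIV. \<psi> x * char_at \<eta> x * (\<psi> y * char_at \<nu> y))"
    by (simp add: gauss_alt sum_product)
  also have "\<dots> = (\<Sum>x\<in>UNIV. \<Sum>s\<in>UNIV. \<psi> s * (char_at \<eta> x * char_at \<nu> (s - x)))"
  proof (rule sum.cong[OF refl])
    fix x
    show "(\<Sum>y\<in>UNIV. \<psi> x * char_at \<eta> x * (\<psi> y * char_at \<nu> y)) =
        (\<Sum>s\<in>UNIV. \<psi> s * (char_at \<eta> x * char_at \<nu> (s - x)))"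
    proof (rule sum.reindex_bij_witness[where i = "\<lambda>s. s - x" and j = "\<lambda>y. x + y"])
      fix y
      have "\<psi> (x + y) = \<psi> x * \<psi> y" using \<psi>(1) by (simp add: add_char_def)
      then show "\<psi> (x + y) * (char_at \<eta> x * char_at \<nu> (x + y - x)) =
          \<psi> x * char_at \<eta> x * (\<psi> y * char_at \<nu> y)"
        by (simp add: mult_ac)
    qed auto
  qed
  also have "\<dots> = (\<Sum>s\<in>UNIV. \<psi> s * ?c s)"
    by (subst sum.swap) (simp add: sum_distrib_left)
  also have "\<dots> = ?c 0 + (\<Sum>s\<in>UNIV - {0}. \<psi> s * ?c s)"
    by (subst sum.remove[of UNIV 0]) (simp_all add: add_char_0[OF \<psi>(1)])
  also have "(\<Sum>s\<in>UNIV - {0}. \<psi> s * ?c s) = - gauss \<psi> (\<eta> * \<nu>) * jacobi \<eta> \<nu>"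
    by (simp add: inner gauss_def sum_distrib_right mult.assoc)
  finally have eq: "gauss \<psi> \<eta> * gauss \<psi> \<nu> = ?c 0 + - gauss \<psi> (\<eta> * \<nu>) * jacobi \<eta> \<nu>" .
  show ?thesis
  proof (cases "\<eta> * \<nu> = 1")
    case True
    then have "\<eta> = inverse \<nu>"
      by (metis inverse_mult_char_cancel(1) mult.commute mult.right_neutral)
    then have "jacobi \<eta> \<nu> = - char_at \<nu> (- 1)" using jacobi_inverse[OF \<nu>] by simp
    then show ?thesis
      unfolding eq c0 using True
      by (simp add: gauss_circ_def gauss_one[OF \<psi>] sum_mult_char algebra_simps)
  next
    case False
    then show ?thesis
      unfolding eq c0 by (simp add: gauss_circ_def sum_mult_char)
  qed
qed

lemma gauss_mult_gauss_inverse: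
  fixes \<psi> :: "'k :: {field, finite} \<Rightarrow> 'c :: field"
  assumes \<psi>: "add_char \<psi>" "\<exists>x. \<psi> x \<noteq> 1" and "\<eta> \<noteq> 1"
  shows "gauss \<psi> \<eta> * gauss \<psi> (inverse \<eta>) = of_nat CARD('k) * char_at \<eta> (- 1)"
  using gauss_mult_gauss[OF assms, of "inverse \<eta>"] jacobi_inverse[OF assms(3)] mult_char_right_inverse[of \<eta>]
  by (simp add: mult.commute gauss_circ_def gauss_one[OF \<psi>])

lemma gauss_nonzero:
  fixes \<psi> :: "'k :: {field, finite} \<Rightarrow> 'c :: field_char_0"
  assumes \<psi>: "add_char \<psi>" "\<exists>x. \<psi> x \<noteq> 1"
  shows "gauss \<psi> \<eta> \<noteq> 0" "gauss_circ \<psi> \<eta> \<noteq> 0"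
proof -
  show "gauss \<psi> \<eta> \<noteq> 0"
  proof (cases "\<eta> = 1")
    case False
    have "of_nat CARD('k) * char_at \<eta> (- 1) \<noteq> 0"
      by (simp add: char_at_nonzero)
    then show ?thesis using gauss_mult_gauss_inverse[OF \<psi> False] by auto
  qed (simp add: gauss_one[OF \<psi>])
  then show "gauss_circ \<psi> \<eta> \<noteq> 0" by (simp add: gauss_circ_def)
qed

section \<open>The binomial theorem and integral representations\<close>

text \<open>
  The right-hand side depends on \<open>\<nu>\<close> only through a factor \<open>\<nu>(t)\<close> in each term of the Jacobi sum. So this
  identity is the Fourier expansion in \<open>\<nu>\<close> of the quotient of Pochhammer symbols.
\<close>

lemma poch_quotient_jacobi:
  fixes \<psi> :: "'k :: {field, finite} \<Rightarrow> 'c :: field_char_0"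
  assumes \<psi>: "add_char \<psi>" "\<exists>x. \<psi> x \<noteq> 1" and "\<alpha> \<noteq> \<gamma>"
  shows "poch \<psi> \<alpha> \<nu> / poch_circ \<psi> \<gamma> \<nu> =
    - gauss_circ \<psi> \<gamma> / (gauss \<psi> \<alpha> * gauss \<psi> (\<gamma> * inverse \<alpha>)) * jacobi (\<alpha> * \<nu>) (\<gamma> * inverse \<alpha>)"
proof -
  have ne: "\<gamma> * inverse \<alpha> \<noteq> 1" using assms(3) by (auto simp: mult_inverse_eq_1_iff)
  have "\<alpha> * \<nu> * (\<gamma> * inverse \<alpha>) = \<gamma> * \<nu>"
    using inverse_mult_char_cancel(2)[of \<alpha> "\<nu> * \<gamma>"] by (simp add: mult_ac)
  then have "gauss \<psi> (\<alpha> * \<nu>) * gauss \<psi> (\<gamma> * inverse \<alpha>) =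
      - gauss_circ \<psi> (\<gamma> * \<nu>) * jacobi (\<alpha> * \<nu>) (\<gamma> * inverse \<alpha>)"
    using gauss_mult_gauss[OF \<psi> ne, of "\<alpha> * \<nu>"] by simp
  then show ?thesis
    using gauss_nonzero[OF \<psi>] by (simp add: poch_def poch_circ_def divide_simps mult_ac)
qed

lemma one_minus_card_nonzero: "1 - of_nat CARD('k :: {field, finite}) \<noteq> (0 :: 'c :: field_char_0)"
  using card_field_gt_1[where 'k = 'k] by (metis eq_iff_diff_eq_0 less_irrefl of_nat_1 of_nat_eq_iff)

text \<open>
  Expanding the coefficients as Jacobi sums and summing over \<open>\<nu>\<close> first, orthogonality leaves the single
  term \<open>t = 1/x\<close>.
\<close>

lemma binomial_theorem_chars:
  fixes \<psi> :: "'k :: {field, finite} \<Rightarrow> 'c :: {alg_closed_field, field_char_0}"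
  assumes \<psi>: "add_char \<psi>" "\<exists>x. \<psi> x \<noteq> 1" and \<beta>: "\<beta> \<noteq> 1" and x: "x \<noteq> 0"
  shows "(\<Sum>\<nu>\<in>UNIV. poch \<psi> \<beta> \<nu> / poch_circ \<psi> 1 \<nu> * char_at \<nu> x) =
    (1 - of_nat CARD('k)) * char_at (inverse \<beta>) (1 - x)"
proof -
  let ?q = "of_nat CARD('k) :: 'c"
  define K where "K = - gauss_circ \<psi> 1 / (gauss \<psi> \<beta> * gauss \<psi> (inverse \<beta>))"
  have K: "K = - char_at \<beta> (- 1)"
    using char_at_minus_one_square[of \<beta>]
    by (simp add: K_def gauss_circ_def gauss_one[OF \<psi>] gauss_mult_gauss_inverse[OF \<psi> \<beta>] field_simps char_at_nonzero)
  have orth: "(\<Sum>\<nu>\<in>(UNIV :: ('k, 'c) mult_char set). char_at \<nu> (t * x)) = (if t = inverse x then ?q - 1 else 0)"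
    if "t \<noteq> 0" for t
    using sum_char_at_over_chars[of "t * x"] that x by (auto simp: field_simps)
  have "(\<Sum>\<nu>\<in>UNIV. poch \<psi> \<beta> \<nu> / poch_circ \<psi> 1 \<nu> * char_at \<nu> x) =
      (\<Sum>\<nu>\<in>UNIV. \<Sum>t\<in>UNIV. K * (char_at \<beta> t * char_at (inverse \<beta>) (1 - t)) * char_at \<nu> (t * x))"
    by (simp add: poch_quotient_jacobi[OF \<psi> \<beta>] K_def jacobi_def sum_distrib_left sum_distrib_right
        char_at_times char_at_mult_all mult_ac)
  also have "\<dots> = (\<Sum>t\<in>UNIV. \<Sum>\<nu>\<in>UNIV. K * (char_at \<beta> t * char_at (inverse \<beta>) (1 - t)) * char_at \<nu> (t * x))"
    by (rule sum.swap)
  also have "\<dots> = (\<Sum>t\<in>UNIV. if t = inverse x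
      then K * (char_at \<beta> t * char_at (inverse \<beta>) (1 - t)) * (?q - 1) else 0)"
  proof (rule sum.cong[OF refl])
    fix t
    show "(\<Sum>\<nu>\<in>UNIV. K * (char_at \<beta> t * char_at (inverse \<beta>) (1 - t)) * char_at \<nu> (t * x)) =
      (if t = inverse x then K * (char_at \<beta> t * char_at (inverse \<beta>) (1 - t)) * (?q - 1) else 0)"
      using x by (cases "t = 0") (simp_all add: char_at_zero orth flip: sum_distrib_left)
  qed
  also have "\<dots> = K * (char_at \<beta> (inverse x) * char_at (inverse \<beta>) (1 - inverse x)) * (?q - 1)"
    by simp
  also have "\<dots> = (1 - ?q) * (inverse (char_at \<beta> (- 1)) * char_at (inverse \<beta>) x * char_at (inverse \<beta>) (1 - inverse x))"
    using char_at_minus_one_square[of \<beta>, THEN inverse_unique]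
    by (simp add: K char_at_inverse char_at_inverse_arg algebra_simps)
  also have "inverse (char_at \<beta> (- 1)) * char_at (inverse \<beta>) x * char_at (inverse \<beta>) (1 - inverse x) =
      char_at (inverse \<beta>) (- 1 * x * (1 - inverse x))"
    by (simp only: char_at_mult_all char_at_inverse)
  also have "- 1 * x * (1 - inverse x) = 1 - x"
    using x by (simp add: algebra_simps)
  finally show ?thesis .
qed

text \<open>
  The coefficient \<open>(\<alpha>)\<^sub>\<nu> / (\<gamma>)\<^sub>\<nu>\<^sup>\<circ>\<close> at \<open>\<nu> = \<nu>\<^sub>1 \<cdots> \<nu>\<^sub>n\<close> is the only part of a term of \<open>F\<^sub>D\<close> that couples the
  summation variables. Its Fourier expansion decouples them, as \<open>\<nu>(t) = \<nu>\<^sub>1(t) \<cdots> \<nu>\<^sub>n(t)\<close>, and the binomial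
  theorem then sums each variable separately.
\<close>

lemma lauricella_FD_integral:
  fixes \<psi> :: "'k :: {field, finite} \<Rightarrow> 'c :: {alg_closed_field, field_char_0}"
  assumes \<psi>: "add_char \<psi>" "\<exists>x. \<psi> x \<noteq> 1" and ne: "\<alpha> \<noteq> \<gamma>"
    and \<beta>: "\<And>i. i \<in> {1..n} \<Longrightarrow> \<beta> i \<noteq> 1" and l: "\<And>i. i \<in> {1..n} \<Longrightarrow> l i \<noteq> 0"
  shows "lauricella_FD \<psi> n \<alpha> \<beta> \<gamma> l =
    - gauss_circ \<psi> \<gamma> / (gauss \<psi> \<alpha> * gauss \<psi> (\<gamma> * inverse \<alpha>)) *
    (\<Sum>t\<in>UNIV. char_at \<alpha> t * char_at (\<gamma> * inverse \<alpha>) (1 - t) *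
      (\<Prod>i=1..n. char_at (inverse (\<beta> i)) (1 - l i * t)))"
proof -
  let ?q = "of_nat CARD('k) :: 'c"
  define P where "P = ({1..n} \<rightarrow>\<^sub>E (UNIV :: ('k, 'c) mult_char set))"
  define K where "K = - gauss_circ \<psi> \<gamma> / (gauss \<psi> \<alpha> * gauss \<psi> (\<gamma> * inverse \<alpha>))"
  define w where "w t = char_at \<alpha> t * char_at (\<gamma> * inverse \<alpha>) (1 - t)" for t
  define a where "a i \<nu> = poch \<psi> (\<beta> i) \<nu> / poch_circ \<psi> 1 \<nu>" for i \<nu>
  (* K * w t is the Fourier coefficient at t; it vanishes at t = 0, where the
     empty product of characters has the value 0 and the empty product of values is 1 *)
  have c: "poch \<psi> \<alpha> \<nu> / poch_circ \<psi> \<gamma> \<nu> = (\<Sum>t\<in>UNIV. K * w t * char_at \<nu> t)" for \<nu>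
    by (simp add: poch_quotient_jacobi[OF \<psi> ne] K_def w_def jacobi_def sum_distrib_left
        char_at_times mult_ac)
  have prod_sum: "(\<Sum>\<nu>\<in>P. \<Prod>i=1..n. a i (\<nu> i) * char_at (\<nu> i) (t * l i)) =
      (1 - ?q) ^ n * (\<Prod>i=1..n. char_at (inverse (\<beta> i)) (1 - l i * t))" if "t \<noteq> 0" for t
  proof -
    have "(\<Sum>\<nu>\<in>P. \<Prod>i=1..n. a i (\<nu> i) * char_at (\<nu> i) (t * l i)) =
        (\<Prod>i=1..n. \<Sum>\<nu>\<in>UNIV. a i \<nu> * char_at \<nu> (t * l i))"
      unfolding P_def by (rule prod_sum_PiE[symmetric]) auto
    also have "\<dots> = (\<Prod>i=1..n. (1 - ?q) * char_at (inverse (\<beta> i)) (1 - l i * t))"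
    proof (rule prod.cong[OF refl])
      fix i assume i: "i \<in> {1..n}"
      have "t * l i \<noteq> 0" using that l[OF i] by simp
      from binomial_theorem_chars[OF \<psi> \<beta>[OF i] this]
      show "(\<Sum>\<nu>\<in>UNIV. a i \<nu> * char_at \<nu> (t * l i)) = (1 - ?q) * char_at (inverse (\<beta> i)) (1 - l i * t)"
        by (simp add: a_def mult.commute[of t])
    qed
    finally show ?thesis by (simp add: prod.distrib)
  qed
  have "(\<Sum>\<nu>\<in>P. poch \<psi> \<alpha> (\<Prod>i=1..n. \<nu> i) * (\<Prod>i=1..n. poch \<psi> (\<beta> i) (\<nu> i)) /
        (poch_circ \<psi> \<gamma> (\<Prod>i=1..n. \<nu> i) * (\<Prod>i=1..n. poch_circ \<psi> 1 (\<nu> i))) *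
        (\<Prod>i=1..n. char_at (\<nu> i) (l i))) =
      (\<Sum>\<nu>\<in>P. poch \<psi> \<alpha> (\<Prod>i=1..n. \<nu> i) / poch_circ \<psi> \<gamma> (\<Prod>i=1..n. \<nu> i) *
        (\<Prod>i=1..n. a i (\<nu> i) * char_at (\<nu> i) (l i)))"
    by (simp add: a_def prod.distrib prod_dividef mult_ac)
  also have "\<dots> = (\<Sum>\<nu>\<in>P. \<Sum>t\<in>UNIV. K * w t * (\<Prod>i=1..n. a i (\<nu> i) * char_at (\<nu> i) (t * l i)))"
  proof (rule sum.cong[OF refl])
    fix \<nu>
    have "K * w t * char_at (\<Prod>i=1..n. \<nu> i) t * (\<Prod>i=1..n. a i (\<nu> i) * char_at (\<nu> i) (l i)) =
        K * w t * (\<Prod>i=1..n. a i (\<nu> i) * char_at (\<nu> i) (t * l i))" for t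
      by (cases "t = 0") (simp_all add: w_def char_at_zero char_at_prod char_at_mult_all prod.distrib mult_ac)
    then show "poch \<psi> \<alpha> (\<Prod>i=1..n. \<nu> i) / poch_circ \<psi> \<gamma> (\<Prod>i=1..n. \<nu> i) *
        (\<Prod>i=1..n. a i (\<nu> i) * char_at (\<nu> i) (l i)) =
        (\<Sum>t\<in>UNIV. K * w t * (\<Prod>i=1..n. a i (\<nu> i) * char_at (\<nu> i) (t * l i)))"
      by (simp only: c sum_distrib_right)
  qed
  also have "\<dots> = (\<Sum>t\<in>UNIV. K * w t * (\<Sum>\<nu>\<in>P. \<Prod>i=1..n. a i (\<nu> i) * char_at (\<nu> i) (t * l i)))"
    by (subst sum.swap) (simp add: sum_distrib_left)
  also have "\<dots> = (\<Sum>t\<in>UNIV. (1 - ?q) ^ n * (K * (w t *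
      (\<Prod>i=1..n. char_at (inverse (\<beta> i)) (1 - l i * t)))))"
  proof (rule sum.cong[OF refl])
    fix t
    show "K * w t * (\<Sum>\<nu>\<in>P. \<Prod>i=1..n. a i (\<nu> i) * char_at (\<nu> i) (t * l i)) =
      (1 - ?q) ^ n * (K * (w t * (\<Prod>i=1..n. char_at (inverse (\<beta> i)) (1 - l i * t))))"
    proof (cases "t = 0")
      case False
      show ?thesis unfolding prod_sum[OF False] by (simp only: mult_ac)
    qed (simp add: w_def char_at_zero)
  qed
  also have "\<dots> = (1 - ?q) ^ n * (K * (\<Sum>t\<in>UNIV. w t *
      (\<Prod>i=1..n. char_at (inverse (\<beta> i)) (1 - l i * t))))"
    by (simp only: sum_distrib_left)
  finally show ?thesis
    unfolding lauricella_FD_def P_def[symmetric] K_def[symmetric] w_def[symmetric]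
    using one_minus_card_nonzero[where 'k = 'k and 'c = 'c] by simp
qed

lemma hyp_2F1_eq_lauricella_FD:
  "hyp_2F1 \<psi> \<alpha> \<beta> \<gamma> x = lauricella_FD \<psi> 1 \<alpha> (\<lambda>_. \<beta>) \<gamma> (\<lambda>_. x)"
proof -
  have "(\<Sum>\<nu>\<in>UNIV. poch \<psi> \<alpha> \<nu> * poch \<psi> \<beta> \<nu> / (poch_circ \<psi> 1 \<nu> * poch_circ \<psi> \<gamma> \<nu>) * char_at \<nu> x) =
    (\<Sum>\<nu>\<in>{1..1 :: nat} \<rightarrow>\<^sub>E UNIV. poch \<psi> \<alpha> (\<nu> 1) * poch \<psi> \<beta> (\<nu> 1) /
      (poch_circ \<psi> \<gamma> (\<nu> 1) * poch_circ \<psi> 1 (\<nu> 1)) * char_at (\<nu> 1) x)"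
    by (rule sum.reindex_bij_witness[where i = "\<lambda>\<nu>. \<nu> 1" and j = "\<lambda>\<nu>. \<lambda>i\<in>{1..1}. \<nu>"])
      (auto simp: mult.commute PiE_iff extensional_def fun_eq_iff)
  then show ?thesis by (simp add: hyp_2F1_def lauricella_FD_def)
qed

lemma hyp_2F1_integral:
  fixes \<psi> :: "'k :: {field, finite} \<Rightarrow> 'c :: {alg_closed_field, field_char_0}"
  assumes "add_char \<psi>" "\<exists>x. \<psi> x \<noteq> 1" "\<alpha> \<noteq> \<gamma>" "\<beta> \<noteq> 1" "x \<noteq> 0"
  shows "hyp_2F1 \<psi> \<alpha> \<beta> \<gamma> x =
    - gauss_circ \<psi> \<gamma> / (gauss \<psi> \<alpha> * gauss \<psi> (\<gamma> * inverse \<alpha>)) *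
    (\<Sum>t\<in>UNIV. char_at \<alpha> t * char_at (\<gamma> * inverse \<alpha>) (1 - t) * char_at (inverse \<beta>) (1 - x * t))"
  unfolding hyp_2F1_eq_lauricella_FD using assms by (subst lauricella_FD_integral) simp_all

section \<open>Roots of unity and \<open>d\<close>-th powers\<close>

lemma has_order_dvd:
  assumes "has_order x d" "x ^ k = 1"
  shows "d dvd k"
proof -
  have "x ^ k = x ^ (d * (k div d) + k mod d)" by simp
  also have "\<dots> = x ^ (k mod d)"
    unfolding power_add power_mult using assms(1) by (simp add: has_order_def)
  finally have "x ^ (k mod d) = 1" using assms(2) by simp
  moreover have "k mod d < d" using assms(1) by (simp add: has_order_def)
  ultimately show ?thesis using assms(1) by (auto simp: has_order_def dvd_eq_mod_eq_0)
qed

lemma has_order_inj_on: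
  assumes "has_order (x :: 'a :: field) d"
  shows "inj_on (\<lambda>i. x ^ i) {..<d}"
proof (rule linorder_inj_onI')
  fix i j assume ij: "i \<in> {..<d}" "j \<in> {..<d}" "i < j"
  have x0: "x \<noteq> 0" using assms by (auto simp: has_order_def power_0_left)
  show "x ^ i \<noteq> x ^ j"
  proof
    assume "x ^ i = x ^ j"
    also have "x ^ j = x ^ i * x ^ (j - i)" using ij(3) by (simp flip: power_add)
    finally have "x ^ (j - i) = 1" using x0 by simp
    then have "d dvd j - i" by (rule has_order_dvd[OF assms])
    then have "d \<le> j - i" using ij(3) by (intro dvd_imp_le) auto
    then show False using ij by simp
  qed
qed

text \<open>
  Both sides are polynomials of degree at most \<open>d\<close> in \<open>x\<close> that agree at the \<open>d + 1\<close> points \<open>0\<close> and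
  \<open>\<xi>\<^sup>-\<^sup>i\<close> for \<open>i < d\<close>.
\<close>

lemma prod_one_minus_roots_of_unity:
  fixes \<xi> :: "'a :: field"
  assumes "has_order \<xi> d"
  shows "(\<Prod>i<d. 1 - \<xi> ^ i * x) = 1 - x ^ d"
proof -
  define p where "p = (\<Prod>i<d. [:1, - (\<xi> ^ i):])"
  define r where "r = 1 - monom (1 :: 'a) d"
  have d: "d > 0" "\<xi> ^ d = 1" using assms by (simp_all add: has_order_def)
  have xi0: "\<xi> \<noteq> 0" using d by (auto simp: power_0_left)
  have pp: "poly p y = (\<Prod>i<d. 1 - \<xi> ^ i * y)" for y
    by (simp add: p_def poly_prod mult.commute)
  have pr: "poly r y = 1 - y ^ d" for y
    by (simp add: r_def poly_monom)
  let ?A = "insert 0 ((\<lambda>i. inverse (\<xi> ^ i)) ` {..<d})"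
  have "inj_on (\<lambda>i. inverse (\<xi> ^ i)) {..<d}"
    using has_order_inj_on[OF assms] by (auto simp: inj_on_def)
  then have cardA: "card ?A = Suc d"
    using xi0 by (subst card_insert_disjoint) (auto simp: card_image)
  have degp: "degree p \<le> d"
    using degree_prod_sum_le[of "{..<d}" "\<lambda>i. [:1, - (\<xi> ^ i):]"] xi0 by (simp add: p_def)
  have degr: "degree r \<le> d"
    unfolding r_def by (intro degree_diff_le) (simp_all add: degree_monom_le)
  have "p = r"
  proof (rule poly_eqI_degree[where A = ?A])
    fix y assume "y \<in> ?A"
    then consider "y = 0" | i where "i < d" "y = inverse (\<xi> ^ i)" by auto
    then show "poly p y = poly r y"
    proof cases
      case 1
      then show ?thesis using d by (simp add: pp pr)
    next
      case 2
      then have "\<exists>i\<in>{..<d}. 1 - \<xi> ^ i * y = 0" using xi0 by (intro bexI[of _ i]) auto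
      then have "poly p y = 0" unfolding pp by (subst prod_zero_iff) auto
      moreover have "y ^ d = 1"
        using 2 d by (simp add: power_inverse flip: power_mult) (simp add: mult.commute power_mult)
      ultimately show ?thesis by (simp add: pr)
    qed
  qed (use degp degr cardA in auto)
  then show ?thesis using pp[of x] pr[of x] by simp
qed

text \<open>
  If \<open>\<phi>(u) = 1\<close>, then \<open>u\<close> is a \<open>d\<close>-th power, because \<open>\<phi>\<close> takes a value of exact order \<open>d\<close> at a generator; its
  \<open>d\<close>-th roots form a coset of the powers of \<open>\<xi>\<close>. Otherwise \<open>u\<close> is not a \<open>d\<close>-th power and the right-hand
  side is a vanishing geometric sum.
\<close>

lemma card_power_fibre:
  fixes \<phi> :: "('k :: {field, finite}, 'c :: field) mult_char"
  assumes \<phi>: "has_order \<phi> d" and \<xi>: "has_order (\<xi> :: 'k) d" and u: "u \<noteq> 0"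
  shows "of_nat (card {t. t ^ d = u}) = (\<Sum>i<d. char_at (\<phi> ^ i) u)"
proof -
  have d: "d > 0" "\<xi> ^ d = 1" "\<phi> ^ d = 1" using \<phi> \<xi> by (simp_all add: has_order_def)
  have xi0: "\<xi> \<noteq> 0" using d by (auto simp: power_0_left)
  have pd: "char_at \<phi> y ^ d = 1" if "y \<noteq> 0" for y
    using that d(3) char_at_pow[OF that, of \<phi> d] by (simp add: char_at_1)
  show ?thesis
  proof (cases "char_at \<phi> u = 1")
    case True
    obtain g :: 'k where gen: "\<And>x. x \<noteq> 0 \<Longrightarrow> \<exists>j. x = g ^ j"
      using finite_field_generator by metis
    obtain k where k: "u = g ^ k" using gen u by blast
    have "has_order (char_at \<phi> g) d" if g0: "g \<noteq> 0"
      unfolding has_order_def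
    proof (intro conjI allI impI notI)
      fix j assume j: "0 < j \<and> j < d" "char_at \<phi> g ^ j = 1"
      have "\<phi> ^ j = 1"
      proof (rule mult_char_eqI)
        fix x :: 'k assume x: "x \<noteq> 0"
        then obtain i where i: "x = g ^ i" using gen by blast
        have "char_at (\<phi> ^ j) x = (char_at \<phi> g ^ j) ^ i"
          using g0 x by (simp add: i char_at_pow char_at_power mult.commute flip: power_mult)
        then show "char_at (\<phi> ^ j) x = char_at 1 x" using j x by (simp add: char_at_1)
      qed
      then show False using \<phi> j by (simp add: has_order_def)
    qed (use d pd g0 in auto)
    moreover have "char_at \<phi> g ^ k = 1" if "g \<noteq> 0"
      using True that by (simp add: k char_at_power)
    ultimately have "\<exists>t. t ^ d = u"
    proof (cases "g = 0")
      case True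
      then have "u = 1" using u k by (auto simp: power_0_left split: if_splits)
      then show ?thesis by (intro exI[of _ 1]) simp
    next
      case False
      assume "g \<noteq> 0 \<Longrightarrow> has_order (char_at \<phi> g) d" "g \<noteq> 0 \<Longrightarrow> char_at \<phi> g ^ k = 1"
      with False have "d dvd k" using has_order_dvd by blast
      then obtain j where "k = d * j" by (rule dvdE)
      then show ?thesis by (intro exI[of _ "g ^ j"]) (simp add: k mult.commute[of d] power_mult)
    qed
    then obtain t0 where t0: "t0 ^ d = u" by blast
    then have t00: "t0 \<noteq> 0" using u d(1) by auto
    have "{t. t ^ d = u} = (\<lambda>i. t0 * inverse (\<xi> ^ i)) ` {..<d}"
    proof (intro equalityI subsetI)
      fix t assume "t \<in> {t. t ^ d = u}"
      then have "(\<Prod>i<d. 1 - \<xi> ^ i * (t / t0)) = 0"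
        unfolding prod_one_minus_roots_of_unity[OF \<xi>] using u t0 by (simp add: power_divide)
      then obtain i where "i < d" "1 - \<xi> ^ i * (t / t0) = 0" by auto
      then show "t \<in> (\<lambda>i. t0 * inverse (\<xi> ^ i)) ` {..<d}"
        using t00 xi0 by (intro image_eqI[of _ _ i]) (simp_all add: field_simps)
    next
      fix t assume "t \<in> (\<lambda>i. t0 * inverse (\<xi> ^ i)) ` {..<d}"
      then obtain i where "t = t0 * inverse (\<xi> ^ i)" by blast
      moreover have "(\<xi> ^ i) ^ d = 1" by (metis d(2) mult.commute power_mult power_one)
      ultimately show "t \<in> {t. t ^ d = u}" using t0 by (simp add: power_mult_distrib power_inverse)
    qed
    moreover have "inj_on (\<lambda>i. t0 * inverse (\<xi> ^ i)) {..<d}"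
      using has_order_inj_on[OF \<xi>] t00 by (auto simp: inj_on_def)
    ultimately have "card {t. t ^ d = u} = d" by (simp add: card_image)
    then show ?thesis using True u by (simp add: char_at_pow)
  next
    case False
    have "char_at \<phi> u ^ d - 1 = (char_at \<phi> u - 1) * (\<Sum>i<d. char_at \<phi> u ^ i)"
      by (rule power_diff_1_eq)
    then have "(\<Sum>i<d. char_at \<phi> u ^ i) = 0" using False pd[OF u] by simp
    moreover have "{t. t ^ d = u} = {}"
    proof (intro equals0I)
      fix t assume "t \<in> {t. t ^ d = u}"
      then have t: "t ^ d = u" "t \<noteq> 0" using u d(1) by auto
      then have "char_at \<phi> u = 1" using pd[of t] char_at_power[of t \<phi> d] by simp
      then show False using False by simp
    qed
    ultimately show ?thesis using u by (simp add: char_at_pow)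
  qed
qed

lemma sum_over_powers:
  fixes \<phi> :: "('k :: {field, finite}, 'c :: field) mult_char" and f :: "'k \<Rightarrow> 'c"
  assumes "has_order \<phi> d" "has_order (\<xi> :: 'k) d" "f 0 = 0"
  shows "(\<Sum>t\<in>UNIV. f (t ^ d)) = (\<Sum>i<d. \<Sum>u\<in>UNIV. char_at (\<phi> ^ i) u * f u)"
proof -
  have "(\<Sum>t\<in>UNIV. f (t ^ d)) = (\<Sum>u\<in>UNIV. \<Sum>t\<in>{t. t ^ d = u}. f (t ^ d))"
    using sum.group[of UNIV UNIV "\<lambda>t :: 'k. t ^ d" "\<lambda>t. f (t ^ d)"] by simp
  also have "\<dots> = (\<Sum>u\<in>UNIV. of_nat (card {t. t ^ d = u}) * f u)"
    by (intro sum.cong refl) simp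
  also have "\<dots> = (\<Sum>u\<in>UNIV. \<Sum>i<d. char_at (\<phi> ^ i) u * f u)"
  proof (rule sum.cong[OF refl])
    fix u
    show "of_nat (card {t. t ^ d = u}) * f u = (\<Sum>i<d. char_at (\<phi> ^ i) u * f u)"
      by (cases "u = 0") (simp_all add: assms(3) card_power_fibre[OF assms(1,2)] sum_distrib_right)
  qed
  also have "\<dots> = (\<Sum>i<d. \<Sum>u\<in>UNIV. char_at (\<phi> ^ i) u * f u)"
    by (rule sum.swap)
  finally show ?thesis .
qed

section \<open>The reduction formula\<close>

theorem theorem3p2:
  fixes \<psi> :: "'k :: {field, finite} \<Rightarrow> qbar"
    and \<alpha> \<beta> \<gamma> \<phi> :: "('k, qbar) mult_char"
    and \<xi> l :: 'k
    and d :: nat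
  assumes "add_char \<psi>" and "\<exists>x. \<psi> x \<noteq> 1"
    and "d \<ge> 1" and "d dvd CARD('k) - 1"
    and "\<alpha> \<noteq> \<gamma>" and "\<beta> \<noteq> 1"
    and "has_order \<phi> d" and "has_order \<xi> d"
    and "l \<noteq> 0"
  shows "lauricella_FD \<psi> (2 * d - 1) (\<alpha> ^ d)
           (\<lambda>i. if i < d then \<alpha> * inverse \<gamma> else \<beta>)
           (\<alpha> ^ (d - 1) * \<gamma>)
           (\<lambda>i. if i < d then \<xi> ^ i else \<xi> ^ (i - d) * l) =
         (\<Sum>i<d. gauss \<psi> (\<phi> ^ i * \<alpha>) * gauss_circ \<psi> (\<alpha> ^ (d - 1) * \<gamma>) /
                  (gauss \<psi> (\<alpha> ^ d) * gauss_circ \<psi> (\<phi> ^ i * \<gamma>)) *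
                  hyp_2F1 \<psi> (\<phi> ^ i * \<alpha>) \<beta> (\<phi> ^ i * \<gamma>) (l ^ d))"
proof -
  note \<psi> = assms(1,2)
  have d: "d > 0" and xi0: "\<xi> \<noteq> 0"
    using assms(3,8) by (auto simp: has_order_def power_0_left)
  define c where "c = \<gamma> * inverse \<alpha>"
  define f where "f u = char_at \<alpha> u * char_at c (1 - u) * char_at (inverse \<beta>) (1 - l ^ d * u)" for u
  define K where "K = - gauss_circ \<psi> (\<alpha> ^ (d - 1) * \<gamma>) / (gauss \<psi> (\<alpha> ^ d) * gauss \<psi> c)"
  have ad: "\<alpha> ^ d = \<alpha> ^ (d - 1) * \<alpha>" using d by (cases d) (simp_all add: mult.commute)
  have quot: "\<mu> * \<gamma> * inverse (\<mu> * \<alpha>) = c" for \<mu>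
  proof (rule mult_char_eqI)
    fix x :: 'k assume "x \<noteq> 0"
    then show "char_at (\<mu> * \<gamma> * inverse (\<mu> * \<alpha>)) x = char_at c x"
      by (simp add: c_def char_at_times char_at_inverse char_at_nonzero)
  qed
  have inv_c: "inverse (\<alpha> * inverse \<gamma>) = c"
    by (rule mult_char_eqI) (simp add: c_def char_at_times char_at_inverse mult.commute)
  let ?B = "\<lambda>i. if i < d then \<alpha> * inverse \<gamma> else \<beta>"
  let ?l = "\<lambda>i. if i < d then \<xi> ^ i else \<xi> ^ (i - d) * l"
  have integrand: "char_at (\<alpha> ^ d) t * char_at c (1 - t) *
      (\<Prod>i=1..2 * d - 1. char_at (inverse (?B i)) (1 - ?l i * t)) = f (t ^ d)" for t
  proof (cases "t = 0")
    case False
    have indices: "{1..2 * d - 1} = {1..<d} \<union> {d..<2 * d}" using d by auto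
    have "(\<Prod>i=1..2 * d - 1. char_at (inverse (?B i)) (1 - ?l i * t)) =
        (\<Prod>i\<in>{1..<d}. char_at c (1 - \<xi> ^ i * t)) *
        (\<Prod>i\<in>{d..<2 * d}. char_at (inverse \<beta>) (1 - \<xi> ^ (i - d) * l * t))"
      unfolding indices by (subst prod.union_disjoint) (auto simp: inv_c)
    also have "(\<Prod>i\<in>{d..<2 * d}. char_at (inverse \<beta>) (1 - \<xi> ^ (i - d) * l * t)) =
        (\<Prod>i<d. char_at (inverse \<beta>) (1 - \<xi> ^ i * (l * t)))"
      by (rule prod.reindex_bij_witness[where i = "\<lambda>i. i + d" and j = "\<lambda>i. i - d"]) (auto simp: mult_ac)
    also have "\<dots> = char_at (inverse \<beta>) (1 - l ^ d * t ^ d)"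
      by (simp add: prod_one_minus_roots_of_unity[OF assms(8)] power_mult_distrib flip: char_at_prod_arg)
    (* the kernel of the integral supplies the missing factor i = 0 of the first product *)
    finally have "char_at c (1 - t) * (\<Prod>i=1..2 * d - 1. char_at (inverse (?B i)) (1 - ?l i * t)) =
        (char_at c (1 - \<xi> ^ 0 * t) * (\<Prod>i\<in>{1..<d}. char_at c (1 - \<xi> ^ i * t))) *
        char_at (inverse \<beta>) (1 - l ^ d * t ^ d)"
      by simp
    also have "char_at c (1 - \<xi> ^ 0 * t) * (\<Prod>i\<in>{1..<d}. char_at c (1 - \<xi> ^ i * t)) =
        (\<Prod>i<d. char_at c (1 - \<xi> ^ i * t))"
      using d by (simp add: lessThan_atLeast0 prod.atLeast_Suc_lessThan)
    also have "\<dots> = char_at c (1 - t ^ d)"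
      by (simp add: prod_one_minus_roots_of_unity[OF assms(8)] flip: char_at_prod_arg)
    finally show ?thesis
      using False by (simp add: f_def char_at_pow char_at_power mult.assoc)
  qed (use d in \<open>simp add: f_def char_at_zero power_0_left\<close>)
  have ne: "\<mu> * \<alpha> \<noteq> \<mu> * \<gamma>" for \<mu>
    using assms(5) by (simp add: mult_char_cancel_left)
  have "lauricella_FD \<psi> (2 * d - 1) (\<alpha> ^ d) ?B (\<alpha> ^ (d - 1) * \<gamma>) ?l = K * (\<Sum>t\<in>UNIV. f (t ^ d))"
  proof (subst lauricella_FD_integral[OF \<psi>])
    show "\<alpha> ^ d \<noteq> \<alpha> ^ (d - 1) * \<gamma>" using ne[of "\<alpha> ^ (d - 1)"] by (simp add: ad)
  next
    have "\<alpha> ^ (d - 1) * \<gamma> * inverse (\<alpha> ^ d) = c" using quot by (simp add: ad)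
    then show "- gauss_circ \<psi> (\<alpha> ^ (d - 1) * \<gamma>) /
        (gauss \<psi> (\<alpha> ^ d) * gauss \<psi> (\<alpha> ^ (d - 1) * \<gamma> * inverse (\<alpha> ^ d))) *
        (\<Sum>t\<in>UNIV. char_at (\<alpha> ^ d) t * char_at (\<alpha> ^ (d - 1) * \<gamma> * inverse (\<alpha> ^ d)) (1 - t) *
          (\<Prod>i=1..2 * d - 1. char_at (inverse (?B i)) (1 - ?l i * t))) = K * (\<Sum>t\<in>UNIV. f (t ^ d))"
      by (simp only: integrand K_def)
  qed (use assms(5,6,9) xi0 in \<open>auto simp: mult_inverse_eq_1_iff\<close>)
  also have "(\<Sum>t\<in>UNIV. f (t ^ d)) = (\<Sum>i<d. \<Sum>u\<in>UNIV. char_at (\<phi> ^ i) u * f u)"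
    by (rule sum_over_powers[OF assms(7,8)]) (simp add: f_def char_at_zero)
  also have "K * \<dots> = (\<Sum>i<d. K * (\<Sum>u\<in>UNIV. char_at (\<phi> ^ i) u * f u))"
    by (rule sum_distrib_left)
  also have "\<dots> = (\<Sum>i<d. gauss \<psi> (\<phi> ^ i * \<alpha>) * gauss_circ \<psi> (\<alpha> ^ (d - 1) * \<gamma>) /
                  (gauss \<psi> (\<alpha> ^ d) * gauss_circ \<psi> (\<phi> ^ i * \<gamma>)) *
                  hyp_2F1 \<psi> (\<phi> ^ i * \<alpha>) \<beta> (\<phi> ^ i * \<gamma>) (l ^ d))"
  proof (rule sum.cong[OF refl])
    fix i
    have "hyp_2F1 \<psi> (\<phi> ^ i * \<alpha>) \<beta> (\<phi> ^ i * \<gamma>) (l ^ d) =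
        - gauss_circ \<psi> (\<phi> ^ i * \<gamma>) / (gauss \<psi> (\<phi> ^ i * \<alpha>) * gauss \<psi> c) *
        (\<Sum>u\<in>UNIV. char_at (\<phi> ^ i) u * f u)"
      using hyp_2F1_integral[OF \<psi> ne[of "\<phi> ^ i"] assms(6), of "l ^ d", unfolded quot] assms(9)
      by (simp add: f_def char_at_times mult.assoc)
    then show "K * (\<Sum>u\<in>UNIV. char_at (\<phi> ^ i) u * f u) =
        gauss \<psi> (\<phi> ^ i * \<alpha>) * gauss_circ \<psi> (\<alpha> ^ (d - 1) * \<gamma>) /
        (gauss \<psi> (\<alpha> ^ d) * gauss_circ \<psi> (\<phi> ^ i * \<gamma>)) *
        hyp_2F1 \<psi> (\<phi> ^ i * \<alpha>) \<beta> (\<phi> ^ i * \<gamma>) (l ^ d)"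
      using gauss_nonzero[OF \<psi>] by (simp add: K_def)
  qed
  finally show ?thesis .
qed

end
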